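(* Let $A\in\mathbb{C}^{n\times n}$ be a matrix all of whose eigenvalues have negative real part, let $\mathcal{S}\subset\mathbb{C}^{n\times n}$ be a complex-linear or real-linear subspace, let $0<\varepsilon<\varepsilon_\star$, where $\varepsilon_\star$ is the (unstructured) stability radius of $A$, and let $\delta=\delta_\varepsilon^{\mathcal{S}}(A)$ be the $\mathcal{S}$-structured $\varepsilon$-stability radius of $A$. Then for every $\Delta\in\mathcal{S}$ with $\|\Delta\|_F\le \delta_\varepsilon^{\mathcal{S}}(A)$, $$ \bigl\| \mathrm{e}^{t(A+\Delta)} \bigr\|_2 \le \frac{|\Gamma|}{2\pi\varepsilon}\qquad\text{for all } t>0, $$ where $\Gamma$ is a closed contour in the closed left complex half-plane that is a union of (i) the part in the left half-plane of a contour (or union of several contours) that surrounds the pseudospectrum $\Lambda_{\varepsilon+\delta}(A)$ and (ii) one or several intervals on the imaginary axis that close the contour, and where $|\Gamma|$ is the length of $\Gamma$.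
   Context: $\|\cdot\|_F$ is the Frobenius norm and $\|\cdot\|_2$ the matrix 2-norm (spectral norm). For $\varepsilon>0$ and $M\in\mathbb{C}^{n\times n}$, the unstructured $\varepsilon$-pseudospectrum is $$\Lambda_\varepsilon(M)=\{\lambda\in\mathbb{C}: \lambda \text{ is an eigenvalue of } M+\Theta \text{ for some } \Theta\in\mathbb{C}^{n\times n} \text{ with } \|\Theta\|_F\le\varepsilon\}=\{\lambda\in\mathbb{C}: \|(M-\lambda I)^{-1}\|_2\ge \varepsilon^{-1}\},$$ with the convention that the resolvent norm is $\infty$ when $\lambda$ is an eigenvalue of $M$. The stability radius $\varepsilon_\star=\varepsilon_\star(A)$ is the largest $\varepsilon>0$ such that $\Lambda_\varepsilon(A)$ has no points of positive real part. For $0<\varepsilon<\varepsilon_\star$, the $\mathcal{S}$-structured $\varepsilon$-stability radius $\delta_\varepsilon^{\mathcal{S}}(A)$ is the largest $\delta>0$ such that for every $\Delta\in\mathcal{S}$ with $\|\Delta\|_F\le\delta$, the pseudospectrum $\Lambda_\varepsilon(A+\Delta)$ has no points with positive real part. *)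

theory Defs
  imports "HOL-Complex_Analysis.Complex_Analysis" "HOL-Library.Multiset"
begin

text \<open>The class instance \<open>times\<close> on \<open>vec\<close> is componentwise, so neither \<open>exp\<close> nor \<open>^\<close> from the
  library is the matrix operation; these are built here from the matrix product \<open>**\<close>.\<close>

primrec matrix_power :: "complex^'n^'n \<Rightarrow> nat \<Rightarrow> complex^'n^'n" where
  "matrix_power M 0 = mat 1"
| "matrix_power M (Suc k) = M ** matrix_power M k"

definition matrix_exp :: "complex^'n^'n \<Rightarrow> complex^'n^'n" where
  "matrix_exp M = (\<Sum>k. (1 / fact k) *\<^sub>R matrix_power M k)"

text \<open>The library norm on \<open>complex^'n^'n\<close> is the Frobenius norm.\<close>

lemma norm_eq_frobenius:
  fixes M :: "complex^'n^'n"
  shows "norm M = sqrt (\<Sum>i\<in>UNIV. \<Sum>j\<in>UNIV. (cmod (M $ i $ j))\<^sup>2)"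
  by (simp add: norm_vec_def L2_set_def sum_nonneg)

definition spectral_norm :: "complex^'n^'n \<Rightarrow> real" where
  "spectral_norm M = onorm (\<lambda>v. M *v v)"

definition eigenvalue :: "complex^'n^'n \<Rightarrow> complex \<Rightarrow> bool" where
  "eigenvalue M z \<longleftrightarrow> (\<exists>v. v \<noteq> 0 \<and> M *v v = z *s v)"

definition pseudospectrum :: "real \<Rightarrow> complex^'n^'n \<Rightarrow> complex set" where
  "pseudospectrum e M = {z. \<exists>E. norm E \<le> e \<and> eigenvalue (M + E) z}"

definition no_unstable_points :: "complex set \<Rightarrow> bool" where
  "no_unstable_points K \<longleftrightarrow> (\<forall>z\<in>K. \<not> Re z > 0)"

definition is_largest :: "real set \<Rightarrow> real \<Rightarrow> bool" where
  "is_largest X x \<longleftrightarrow> x \<in> X \<and> (\<forall>y\<in>X. y \<le> x)"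

definition is_stability_radius :: "complex^'n^'n \<Rightarrow> real \<Rightarrow> bool" where
  "is_stability_radius A r \<longleftrightarrow> is_largest {e. 0 < e \<and> no_unstable_points (pseudospectrum e A)} r"

text \<open>A relation rather than a function: for some \<open>S\<close> (for instance \<open>{0}\<close>) every \<open>d > 0\<close> is
  admissible and there is no largest one.\<close>

definition is_structured_stability_radius ::
    "(complex^'n^'n) set \<Rightarrow> real \<Rightarrow> complex^'n^'n \<Rightarrow> real \<Rightarrow> bool" where
  "is_structured_stability_radius S e A r \<longleftrightarrow>
     is_largest {d. 0 < d \<and> (\<forall>D\<in>S. norm D \<le> d \<longrightarrow> no_unstable_points (pseudospectrum e (A + D)))} r"

definition path_length :: "(real \<Rightarrow> complex) \<Rightarrow> real" where
  "path_length g = integral {0..1} (\<lambda>s. norm (vector_derivative g (at s)))"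

text \<open>A closed contour, or a union of several, is given by the finite list of arcs it consists of.
  The list closes up iff every point is as often a starting point as an end point; the arcs can then
  be concatenated to finitely many closed paths. The speed of a \<open>valid_path\<close> may be unbounded near
  its finitely many exceptional points, so finite length has to be required separately.\<close>

definition closed_contour :: "(real \<Rightarrow> complex) list \<Rightarrow> bool" where
  "closed_contour C \<longleftrightarrow>
     (\<forall>g\<in>set C. valid_path g \<and> (\<lambda>s. norm (vector_derivative g (at s))) integrable_on {0..1}) \<and>
     mset (map pathstart C) = mset (map pathfinish C)"

definition contour_image :: "(real \<Rightarrow> complex) list \<Rightarrow> complex set" where
  "contour_image C = (\<Union>g\<in>set C. path_image g)"

definition contour_length :: "(real \<Rightarrow> complex) list \<Rightarrow> real" where
  "contour_length C = sum_list (map path_length C)"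

text \<open>The winding number of the whole contour is the sum over its arcs. A contour disjoint from \<open>K\<close>
  surrounds \<open>K\<close> iff it winds once (positively) around every point of \<open>K\<close>; parts of the contour may also
  run along the boundary of \<open>K\<close>.\<close>

definition surrounds :: "(real \<Rightarrow> complex) list \<Rightarrow> complex set \<Rightarrow> bool" where
  "surrounds C K \<longleftrightarrow>
     contour_image C \<inter> interior K = {} \<and>
     (\<forall>z\<in>K - contour_image C. sum_list (map (\<lambda>g. winding_number g z) C) = 1)"

text \<open>The surrounding contour consists of arcs \<open>L\<close> in the closed left and arcs \<open>R\<close> in the closed right
  half-plane; in \<open>G\<close> the arcs \<open>R\<close> are replaced by oriented intervals \<open>J\<close> on the imaginary axis.\<close>

definition left_half_contour :: "complex set \<Rightarrow> (real \<Rightarrow> complex) list \<Rightarrow> bool" where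
  "left_half_contour K G \<longleftrightarrow>
     (\<exists>L R J.
        closed_contour (L @ R) \<and> surrounds (L @ R) K \<and>
        contour_image L \<subseteq> {z. Re z \<le> 0} \<and> contour_image R \<subseteq> {z. Re z \<ge> 0} \<and>
        (\<forall>g\<in>set J. \<exists>a b. g = linepath (\<i> * complex_of_real a) (\<i> * complex_of_real b)) \<and>
        G = L @ J \<and> closed_contour G)"

end

theory Submission
  imports Defs "HOL-Computational_Algebra.Fundamental_Theorem_Algebra"
begin

text \<open>The bound is the standard estimate of \<open>exp (t B) = 1 / (2 \<pi> i) \<integral>\<^sub>\<Gamma> exp (t z) (z - B)\<^sup>-\<^sup>1 dz\<close> for
  \<open>B = A + \<Delta>\<close>, using \<open>|exp (t z)| \<le> 1\<close> on \<open>\<Gamma>\<close>. A rank-one perturbation shows that points with resolvent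
  norm larger than \<open>1 / \<epsilon>\<close> are interior points of the \<open>\<epsilon>\<close>-pseudospectrum of \<open>B\<close>. This set lies in the
  pseudospectrum of \<open>A\<close> to level \<open>\<epsilon> + \<delta>\<close> and contains no points with positive real part, so
  \<open>\<Gamma>\<close> does not meet its interior. The contour is only given as a list of arcs; the integral formula
  is therefore obtained without the residue theorem: applying \<open>(z - B)\<^sup>-\<^sup>1\<close> to a vector annihilated by
  a polynomial in \<open>B\<close> gives rational functions with poles at eigenvalues, whose integrals follow from
  partial fractions and the winding numbers.\<close>

subsection \<open>Integrals over lists of arcs\<close>

text \<open>The witness \<open>i\<close> assigns a value to each arc, so integrability along every
  arc and the value of the sum are asserted together; repeated arcs count with multiplicity.\<close>

definition has_cycle_integral ::
    "(complex \<Rightarrow> complex) \<Rightarrow> complex \<Rightarrow> (real \<Rightarrow> complex) list \<Rightarrow> bool" where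
  "has_cycle_integral f I C \<longleftrightarrow>
     (\<exists>i. (\<forall>g\<in>set C. (f has_contour_integral i g) g) \<and> (\<Sum>g\<leftarrow>C. i g) = I)"

lemma has_cycle_integral_unique:
  assumes "has_cycle_integral f I C" and "has_cycle_integral f I' C"
  shows "I = I'"
proof -
  obtain i j where "\<forall>g\<in>set C. (f has_contour_integral i g) g" "(\<Sum>g\<leftarrow>C. i g) = I"
      "\<forall>g\<in>set C. (f has_contour_integral j g) g" "(\<Sum>g\<leftarrow>C. j g) = I'"
    using assms by (auto simp: has_cycle_integral_def)
  then show ?thesis
    by (metis (no_types, lifting) has_contour_integral_unique map_cong)
qed

lemma has_cycle_integral_cong:
  assumes "has_cycle_integral f I C" and "\<And>z. z \<in> contour_image C \<Longrightarrow> f z = f' z" and "I = I'"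
  shows "has_cycle_integral f' I' C"
proof -
  obtain i where i: "\<forall>g\<in>set C. (f has_contour_integral i g) g" "(\<Sum>g\<leftarrow>C. i g) = I"
    using assms(1) by (auto simp: has_cycle_integral_def)
  have "(f' has_contour_integral i g) g" if "g \<in> set C" for g
    by (rule has_contour_integral_eq[of f]) (use i that assms(2) in \<open>auto simp: contour_image_def\<close>)
  then show ?thesis
    using i assms(3) unfolding has_cycle_integral_def by blast
qed

lemma has_cycle_integral_0: "has_cycle_integral (\<lambda>z. 0) 0 C"
  unfolding has_cycle_integral_def
  by (rule exI[of _ "\<lambda>g. 0"]) (simp add: has_contour_integral_0)

lemma has_cycle_integral_add:
  assumes "has_cycle_integral f I C" and "has_cycle_integral f' I' C"
  shows "has_cycle_integral (\<lambda>z. f z + f' z) (I + I') C"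
proof -
  obtain i j where "\<forall>g\<in>set C. (f has_contour_integral i g) g" "(\<Sum>g\<leftarrow>C. i g) = I"
      "\<forall>g\<in>set C. (f' has_contour_integral j g) g" "(\<Sum>g\<leftarrow>C. j g) = I'"
    using assms by (auto simp: has_cycle_integral_def)
  then show ?thesis
    unfolding has_cycle_integral_def
    by (intro exI[of _ "\<lambda>g. i g + j g"]) (simp add: has_contour_integral_add sum_list_addf)
qed

lemma has_cycle_integral_append:
  assumes "has_cycle_integral f I C" and "has_cycle_integral f I' C'"
  shows "has_cycle_integral f (I + I') (C @ C')"
proof -
  \<comment> \<open>The witnesses for \<open>C\<close> and \<open>C'\<close> may come from different
    functions; replacing both by \<open>contour_integral g f\<close> gives a single one for the
    joined list.\<close>
  have *: "(\<forall>g\<in>set C. (f has_contour_integral contour_integral g f) g)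
      \<and> (\<Sum>g\<leftarrow>C. contour_integral g f) = I" if f: "has_cycle_integral f I C" for I C
  proof -
    obtain i where "\<forall>g\<in>set C. (f has_contour_integral i g) g" "(\<Sum>g\<leftarrow>C. i g) = I"
      using f by (auto simp: has_cycle_integral_def)
    moreover from this(1) have "map i C = map (\<lambda>g. contour_integral g f) C"
      by (intro map_cong refl) (metis contour_integral_unique)
    ultimately show ?thesis
      by (auto dest: contour_integral_unique)
  qed
  show ?thesis
    unfolding has_cycle_integral_def
    by (rule exI[of _ "\<lambda>g. contour_integral g f"]) (use *[OF assms(1)] *[OF assms(2)] in auto)
qed

lemma has_cycle_integral_lmul:
  assumes "has_cycle_integral f I C"
  shows "has_cycle_integral (\<lambda>z. c * f z) (c * I) C"
proof -
  obtain i where "\<forall>g\<in>set C. (f has_contour_integral i g) g" "(\<Sum>g\<leftarrow>C. i g) = I"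
    using assms by (auto simp: has_cycle_integral_def)
  then show ?thesis
    unfolding has_cycle_integral_def
    by (intro exI[of _ "\<lambda>g. c * i g"]) (simp add: has_contour_integral_lmul sum_list_const_mult)
qed

lemma has_cycle_integral_sum:
  assumes "finite X" and "\<And>k. k \<in> X \<Longrightarrow> has_cycle_integral (f k) (I k) C"
  shows "has_cycle_integral (\<lambda>z. \<Sum>k\<in>X. f k z) (\<Sum>k\<in>X. I k) C"
  using assms
  by (induction X rule: finite_induct) (auto intro: has_cycle_integral_0 has_cycle_integral_add)

text \<open>Equal multisets of end points have equal sums under any \<open>F\<close>. This replaces
  telescoping along a closed path, whatever the order of the arcs.\<close>

lemma sum_pathstart_eq_pathfinish:
  fixes F :: "complex \<Rightarrow> complex"
  assumes "closed_contour C"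
  shows "(\<Sum>g\<leftarrow>C. F (pathstart g)) = (\<Sum>g\<leftarrow>C. F (pathfinish g))"
proof -
  have "sum_mset (image_mset F (mset (map pathstart C))) = sum_mset (image_mset F (mset (map pathfinish C)))"
    using assms by (simp add: closed_contour_def)
  then show ?thesis
    by (simp flip: sum_mset_sum_list add: image_mset.compositionality comp_def)
qed

lemma has_cycle_integral_primitive:
  assumes "\<And>z. z \<in> X \<Longrightarrow> (F has_field_derivative f z) (at z)"
    and "\<And>g. g \<in> set C \<Longrightarrow> valid_path g" and "contour_image C \<subseteq> X"
  shows "has_cycle_integral f (\<Sum>g\<leftarrow>C. F (pathfinish g) - F (pathstart g)) C"
proof -
  have "(f has_contour_integral F (pathfinish g) - F (pathstart g)) g" if "g \<in> set C" for g
    by (rule contour_integral_primitive[of X])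
       (use assms that in \<open>auto simp: contour_image_def intro: has_field_derivative_at_within\<close>)
  then show ?thesis
    unfolding has_cycle_integral_def by (intro exI) auto
qed

lemma has_cycle_integral_closed_primitive:
  assumes "closed_contour C" and "\<And>z. z \<in> contour_image C \<Longrightarrow> (F has_field_derivative f z) (at z)"
  shows "has_cycle_integral f 0 C"
  using has_cycle_integral_primitive[of "contour_image C" F f C] assms
    sum_pathstart_eq_pathfinish[OF assms(1), of F]
  by (auto simp: closed_contour_def sum_list_subtractf)

text \<open>The usual length estimate, arc by arc; the dominating integral exists because
  \<open>closed_contour\<close> includes integrable speed.\<close>

lemma has_cycle_integral_norm_le:
  assumes "has_cycle_integral f I C" and "closed_contour C"
    and "\<And>z. z \<in> contour_image C \<Longrightarrow> cmod (f z) \<le> c"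
  shows "cmod I \<le> c * contour_length C"
proof -
  obtain i where i: "\<forall>g\<in>set C. (f has_contour_integral i g) g" "(\<Sum>g\<leftarrow>C. i g) = I"
    using assms by (auto simp: has_cycle_integral_def)
  have le: "cmod (i g) \<le> c * path_length g" if "g \<in> set C" for g
  proof -
    have f: "((\<lambda>s. f (g s) * vector_derivative g (at s)) has_integral i g) {0..1}"
      using i that by (simp add: has_contour_integral)
    have "norm (integral {0..1} (\<lambda>s. f (g s) * vector_derivative g (at s)))
        \<le> integral {0..1} (\<lambda>s. c * norm (vector_derivative g (at s)))"
    proof (rule integral_norm_bound_integral)
      show "(\<lambda>s. c * norm (vector_derivative g (at s))) integrable_on {0..1}"
        using assms(2) that by (intro integrable_on_mult_right) (auto simp: closed_contour_def)
      show "norm (f (g s) * vector_derivative g (at s)) \<le> c * norm (vector_derivative g (at s))"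
        if "s \<in> {0..1}" for s
        proof -
        have "g s \<in> contour_image C"
          using that \<open>g \<in> set C\<close> unfolding contour_image_def path_image_def by blast
        then show ?thesis
          using assms(3) by (simp add: norm_mult mult_right_mono)
      qed
    qed (use f in blast)
    then show ?thesis
      using f by (simp add: path_length_def integral_unique)
  qed
  have "cmod I \<le> (\<Sum>g\<leftarrow>C. cmod (i g))"
    unfolding i(2)[symmetric] by (induction C) (auto intro: norm_triangle_le)
  also have "\<dots> \<le> (\<Sum>g\<leftarrow>C. c * path_length g)"
    using le by (rule sum_list_mono)
  finally show ?thesis
    by (simp add: contour_length_def sum_list_const_mult)
qed

text \<open>The arcs may be open: \<open>winding_number\<close> is then a complex number, but still
  the normalised integral of \<open>inverse (z - a)\<close> along the arc.\<close>

lemma has_cycle_integral_inverse_diff: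
  assumes "\<And>g. g \<in> set C \<Longrightarrow> valid_path g" and "a \<notin> contour_image C"
  shows "has_cycle_integral (\<lambda>z. inverse (z - a))
           (2 * pi * \<i> * (\<Sum>g\<leftarrow>C. winding_number g a)) C"
proof -
  have "((\<lambda>z. inverse (z - a)) has_contour_integral 2 * pi * \<i> * winding_number g a) g"
    if "g \<in> set C" for g
    using has_contour_integral_winding_number[of g a] assms that
    by (auto simp: contour_image_def inverse_eq_divide)
  then show ?thesis
    unfolding has_cycle_integral_def
    by (intro exI[of _ "\<lambda>g. 2 * pi * \<i> * winding_number g a"]) (simp add: sum_list_const_mult)
qed

text \<open>Partial fractions reduce products with at least two different factors to fewer factors; a
  pure power of order at least two has a primitive.\<close>

lemma has_cycle_integral_inverse_prod:
  assumes "closed_contour C"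
    and "\<And>a. a \<in># N \<Longrightarrow> a \<notin> contour_image C"
    and "\<And>a. a \<in># N \<Longrightarrow> has_cycle_integral (\<lambda>z. inverse (z - a)) c C"
    and "N \<noteq> {#}"
  shows "has_cycle_integral (\<lambda>z. inverse (\<Prod>a\<in>#N. z - a)) (if size N = 1 then c else 0) C"
  using assms(2-)
proof (induction "size N" arbitrary: N rule: less_induct)
  case less
  show ?case
  proof (cases "\<exists>a b. a \<in># N \<and> b \<in># N \<and> a \<noteq> b")
    case True
    then obtain a b where ab: "a \<in># N" "b \<in># N" "a \<noteq> b"
      by blast
    define M where "M = N - {#a#} - {#b#}"
    have N: "N = add_mset a (add_mset b M)"
      using ab unfolding M_def by (metis insert_DiffM insert_noteq_member)
    let ?c = "if size (add_mset a M) = 1 then c else 0"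
    have "has_cycle_integral (\<lambda>z. inverse (\<Prod>a\<in>#add_mset d M. z - a)) ?c C" if "d = a \<or> d = b" for d
    proof -
      have "has_cycle_integral (\<lambda>z. inverse (\<Prod>a\<in>#add_mset d M. z - a))
          (if size (add_mset d M) = 1 then c else 0) C"
      proof (rule less.hyps)
        show "size (add_mset d M) < size N"
          by (simp add: N)
        show "x \<notin> contour_image C" if "x \<in># add_mset d M" for x
          by (rule less.prems(1)) (use that \<open>d = a \<or> d = b\<close> in \<open>auto simp: N\<close>)
        show "has_cycle_integral (\<lambda>z. inverse (z - x)) c C" if "x \<in># add_mset d M" for x
          by (rule less.prems(2)) (use that \<open>d = a \<or> d = b\<close> in \<open>auto simp: N\<close>)
      qed simp
      then show ?thesis
        by simp
    qed
    note * = this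
    \<comment> \<open>Removing \<open>a\<close> or \<open>b\<close> leaves multisets of equal size,
      hence equal integrals \<open>?c\<close>, and their difference vanishes, as required for
      \<open>size N\<close> at least 2.\<close>
    have "has_cycle_integral (\<lambda>z. inverse (a - b) *
        (inverse (\<Prod>a\<in>#add_mset a M. z - a) + - 1 * inverse (\<Prod>a\<in>#add_mset b M. z - a)))
        (inverse (a - b) * (?c + - 1 * ?c)) C"
      by (intro has_cycle_integral_lmul has_cycle_integral_add *) simp_all
    then show ?thesis
    proof (rule has_cycle_integral_cong)
      fix z assume "z \<in> contour_image C"
      then have "z \<noteq> a" "z \<noteq> b"
        using less.prems(1) ab by auto
      then have "inverse (a - b) * (inverse (z - a) - inverse (z - b)) = inverse (z - a) * inverse (z - b)"
        using ab(3) by (simp add: field_simps)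
      then have "inverse (a - b) * (inverse (z - a) - inverse (z - b)) * inverse (\<Prod>a\<in>#M. z - a)
          = inverse (z - a) * inverse (z - b) * inverse (\<Prod>a\<in>#M. z - a)"
        by simp
      then show "inverse (a - b) * (inverse (\<Prod>a\<in>#add_mset a M. z - a)
          + - 1 * inverse (\<Prod>a\<in>#add_mset b M. z - a)) = inverse (\<Prod>a\<in>#N. z - a)"
        unfolding N image_mset_add_mset prod_mset.add_mset inverse_mult_distrib
        by (simp add: algebra_simps)
    qed (simp add: N)
  next
    case False
    obtain a where a: "a \<in># N"
      using less.prems(3) by blast
    define k where "k = size N"
    have N: "N = replicate_mset k a"
      using False a unfolding k_def by (metis set_mset_subset_singletonD singletonI subsetI)
    have prod: "(\<Prod>a\<in>#N. z - a) = (z - a) ^ k" for z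
      by (simp add: N prod_mset_constant)
    show ?thesis
    proof (cases "k = 1")
      case True
      then show ?thesis
        using less.prems(2)[OF a] by (simp add: prod k_def)
    next
      case k: False
      \<comment> \<open>The exponent is at least 2, so the primitive is a multiple of the power
        \<open>Suc m\<close> of \<open>inverse (z - a)\<close>, with no logarithm.\<close>
      then obtain m where m: "k = Suc (Suc m)"
        using less.prems(3) k_def by (metis One_nat_def nat.exhaust size_eq_0_iff_empty)
      have "has_cycle_integral (\<lambda>z. inverse (\<Prod>a\<in>#N. z - a)) 0 C"
        unfolding prod
      proof (rule has_cycle_integral_closed_primitive[OF assms(1)])
        fix z assume "z \<in> contour_image C"
        then have "z \<noteq> a"
          using less.prems(1) a by auto
        then have "((\<lambda>z. inverse (z - a)) has_field_derivative - (inverse (z - a))\<^sup>2) (at z)"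
          by (auto intro!: derivative_eq_intros simp: power2_eq_square)
        note * = DERIV_cmult[OF DERIV_power_Suc[OF this], of "- inverse (of_nat (Suc m))" m]
        show "((\<lambda>z. - inverse (of_nat (Suc m)) * inverse (z - a) ^ Suc m)
            has_field_derivative inverse ((z - a) ^ k)) (at z)"
          by (rule DERIV_cong[OF *])
            (use of_nat_neq_0[of m, where 'a = complex] in
              \<open>simp add: m power2_eq_square power_inverse\<close>)
      qed
      then show ?thesis
        using k by (simp add: k_def)
    qed
  qed
qed

subsection \<open>Annihilating polynomials\<close>

lemma norm_vector_scalar_mult: "norm (c *s x) = cmod c * norm x" for x :: "complex^'n"
  by (simp add: norm_vec_def norm_mult L2_set_right_distrib)

lemma scaleR_eq_vector_scalar_mult: "c *\<^sub>R x = complex_of_real c *s x" for x :: "complex^'n"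
  by (simp add: vec_eq_iff scaleR_conv_of_real[where 'a=complex])

text \<open>This is the vector p(B) x.\<close>

definition poly_apply :: "complex poly \<Rightarrow> complex^'n^'n \<Rightarrow> complex^'n \<Rightarrow> complex^'n" where
  "poly_apply p B x = (\<Sum>k\<le>degree p. coeff p k *s (matrix_power B k *v x))"

text \<open>Padding with zero coefficients lets polynomials of different degrees share one summation
  range.\<close>

lemma poly_apply_eq_sum:
  assumes "degree p \<le> m"
  shows "poly_apply p B x = (\<Sum>k\<le>m. coeff p k *s (matrix_power B k *v x))"
  unfolding poly_apply_def using assms
  by (intro sum.mono_neutral_left) (auto simp: coeff_eq_0)

lemma matrix_power_Suc_apply: "matrix_power B (Suc k) *v x = B *v (matrix_power B k *v x)"
  by (simp add: matrix_vector_mul_assoc)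

lemma matrix_power_apply_comm: "matrix_power B k *v (B *v x) = B *v (matrix_power B k *v x)"
  by (induction k) (simp_all add: matrix_vector_mul_assoc[symmetric])

lemma matrix_vector_mult_sum: "B *v (\<Sum>k\<in>X. f k) = (\<Sum>k\<in>X. B *v f k)" for B :: "complex^'n^'n"
  by (induction X rule: infinite_finite_induct) (auto simp: matrix_vector_right_distrib)

lemma poly_apply_linear_mult:
  "poly_apply ([:- a, 1:] * q) B x = B *v poly_apply q B x - a *s poly_apply q B x"
proof -
  define m where "m = degree q"
  have c0: "coeff q (Suc m) = 0"
    by (simp add: m_def coeff_eq_0)
  have "poly_apply ([:- a, 1:] * q) B x
      = (\<Sum>k\<le>Suc m. coeff ([:- a, 1:] * q) k *s (matrix_power B k *v x))"
    by (rule poly_apply_eq_sum) (use degree_mult_le[of "[:- a, 1:]" q] in \<open>simp add: m_def\<close>)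
  \<comment> \<open>Multiplication by X is the coefficient shift \<open>pCons 0 q\<close>, which
    becomes an application of \<open>B\<close> after reindexing.\<close>
  also have "\<dots> = (\<Sum>k\<le>Suc m. coeff (pCons 0 q) k *s (matrix_power B k *v x))
      - a *s (\<Sum>k\<le>Suc m. coeff q k *s (matrix_power B k *v x))"
    by (simp add: sum_subtractf[symmetric] vec.scale_sum_right vec.scale_left_diff_distrib
        del: matrix_power.simps sum.atMost_Suc)
  also have "(\<Sum>k\<le>Suc m. coeff (pCons 0 q) k *s (matrix_power B k *v x)) = B *v poly_apply q B x"
    by (subst sum.atMost_Suc_shift)
      (simp add: matrix_power_Suc_apply poly_apply_def m_def matrix_vector_mult_sum
        vector_scalar_commute del: matrix_power.simps)
  also have "(\<Sum>k\<le>Suc m. coeff q k *s (matrix_power B k *v x)) = poly_apply q B x"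
    using c0 by (simp add: poly_apply_def m_def del: matrix_power.simps)
  finally show ?thesis .
qed

text \<open>q(B) commutes with B - a. Together with \<open>poly_apply_linear_mult\<close>, if (X -
  a) q annihilates \<open>x\<close>, then q annihilates (B - a) x.\<close>

lemma poly_apply_linear_image:
  "poly_apply q B (B *v x - a *s x) = B *v poly_apply q B x - a *s poly_apply q B x"
  by (simp add: poly_apply_def matrix_vector_mult_diff_distrib matrix_power_apply_comm
      vector_scalar_commute matrix_vector_mult_sum vec.scale_sum_right vec.scale_right_diff_distrib
      sum_subtractf mult.commute)

text \<open>The iterates of \<open>x\<close> with exponents up to the real dimension outnumber it by
  one, so they are linearly dependent; the coefficients of a dependence form the polynomial.\<close>

lemma ex_annihilating_poly:
  fixes B :: "complex^'n^'n"
  shows "\<exists>p. p \<noteq> 0 \<and> poly_apply p B x = 0"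
proof -
  define v where "v k = matrix_power B k *v x" for k
  define X where "X = {..DIM(complex^'n)}"
  show ?thesis
  proof (cases "inj_on v X")
    case False
    then obtain i j where ij: "i \<noteq> j" "v i = v j"
      by (auto simp: inj_on_def)
    let ?p = "monom 1 i - monom 1 j :: complex poly"
    have nz: "?p \<noteq> 0"
      using ij by (metis coeff_diff coeff_monom diff_0_right zero_neq_one coeff_0)
    have deg: "degree ?p \<le> max i j"
      by (intro degree_diff_le_max[THEN order_trans]) (simp add: degree_monom_eq)
    have "poly_apply ?p B x = (\<Sum>k\<le>max i j. (if i = k then v k else 0) - (if j = k then v k else 0))"
      unfolding poly_apply_eq_sum[OF deg] v_def[symmetric]
      by (intro sum.cong) (auto simp: vec.scale_left_diff_distrib)
    also have "\<dots> = 0"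
      using ij by (simp add: sum_subtractf)
    finally show ?thesis
      using nz by blast
  next
    case True
    then have "card (v ` X) > DIM(complex^'n)"
      by (subst card_image) (auto simp: X_def)
    then have "dependent (v ` X)"
      by (intro dependent_biggerset) 
    then obtain u where u: "\<exists>y\<in>v ` X. u y \<noteq> 0" "(\<Sum>y\<in>v ` X. u y *\<^sub>R y) = 0"
      by (auto simp: dependent_finite X_def)
    define p where "p = (\<Sum>k\<in>X. monom (complex_of_real (u (v k))) k)"
    have c: "coeff p k = (if k \<in> X then complex_of_real (u (v k)) else 0)" for k
      by (simp add: p_def coeff_sum X_def)
    have "p \<noteq> 0"
      using u(1) c by (metis coeff_0 imageE of_real_eq_0_iff)
    moreover have "degree p \<le> DIM(complex^'n)"
      by (intro degree_le) (simp add: c X_def)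
    then have "poly_apply p B x = (\<Sum>k\<in>X. u (v k) *\<^sub>R v k)"
      unfolding poly_apply_eq_sum[OF \<open>degree p \<le> _\<close>] v_def[symmetric] X_def[symmetric]
      by (intro sum.cong) (auto simp: c scaleR_eq_vector_scalar_mult)
    moreover have "\<dots> = 0"
      using u(2) True by (simp add: sum.reindex X_def)
    ultimately show ?thesis
      by auto
  qed
qed

text \<open>Roots are split off an annihilating polynomial of \<open>x\<close> one by one. If the
  root \<open>a\<close> is an eigenvalue, the quotient annihilates (B - a) x; otherwise B - a is
  injective and the quotient already annihilates \<open>x\<close>. A nonzero constant forces x = 0.
  This takes the place of a decomposition into generalised eigenvectors.\<close>

lemma eigenvalue_induct [case_names zero step]:
  fixes B :: "complex^'n^'n"
  assumes "P 0" and step: "\<And>a x. eigenvalue B a \<Longrightarrow> P (B *v x - a *s x) \<Longrightarrow> P x"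
  shows "P x"
proof -
  obtain p where "p \<noteq> 0" "poly_apply p B x = 0"
    using ex_annihilating_poly by blast
  then show ?thesis
  proof (induction "degree p" arbitrary: p x)
    case 0
    then have "coeff p 0 \<noteq> 0"
      by (metis leading_coeff_0_iff)
    then have "x = 0"
      using 0 by (simp add: poly_apply_def)
    then show ?case
      using assms(1) by simp
  next
    case (Suc m)
    then have "\<not> constant (poly p)"
      by (metis constant_degree nat.distinct(1))
    then obtain a where "poly p a = 0"
      using fundamental_theorem_of_algebra by blast
    then obtain q where q: "p = [:- a, 1:] * q"
      by (auto simp: poly_eq_0_iff_dvd)
    then have "q \<noteq> 0"
      using Suc.prems by auto
    have m: "m = degree q"
      using Suc.hyps(2) \<open>q \<noteq> 0\<close> unfolding q by (subst (asm) degree_mult_eq) auto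
    show ?case
    proof (cases "eigenvalue B a")
      case True
      have "poly_apply q B (B *v x - a *s x) = 0"
        using Suc.prems(2) unfolding q poly_apply_linear_image poly_apply_linear_mult .
      then have "P (B *v x - a *s x)"
        by (rule Suc.hyps(1)[OF m \<open>q \<noteq> 0\<close>])
      then show ?thesis
        using step True by blast
    next
      case False
      then have "poly_apply q B x = 0"
        using Suc.prems(2) unfolding q poly_apply_linear_mult eigenvalue_def
        by (metis right_minus_eq)
      then show ?thesis
        using Suc.hyps(1)[OF m \<open>q \<noteq> 0\<close>] by blast
    qed
  qed
qed

subsection \<open>Contour integrals of the resolvent\<close>

text \<open>This is the inverse of z - B applied to \<open>x\<close>, meaningful when
  \<open>z\<close> is not an eigenvalue.\<close>

definition resolvent_apply :: "complex^'n^'n \<Rightarrow> complex \<Rightarrow> complex^'n \<Rightarrow> complex^'n" where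
  "resolvent_apply B z x = (THE w. z *s w - B *v w = x)"

lemma resolvent_ex1:
  fixes B :: "complex^'n^'n"
  assumes "\<not> eigenvalue B z"
  shows "\<exists>!w. z *s w - B *v w = x"
proof -
  let ?f = "\<lambda>w. z *s w - B *v w"
  have lin: "linear ?f"
    by (rule linearI)
      (simp_all add: scaleR_eq_vector_scalar_mult matrix_vector_right_distrib
        vec.scale_right_distrib vec.scale_right_diff_distrib vector_scalar_commute mult.commute)
  have inj: "inj ?f"
    using lin by (rule linear_injective_0[THEN iffD2]) (use assms in \<open>auto simp: eigenvalue_def\<close>)
  have "surj ?f"
    using linear_inj_imp_surj[OF lin inj] .
  then obtain w where "?f w = x"
    by (auto simp: surj_def) metis
  then show ?thesis
    using injD[OF inj] by blast
qed

lemma resolvent_apply_eq: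
  assumes "\<not> eigenvalue B z"
  shows "z *s resolvent_apply B z x - B *v resolvent_apply B z x = x"
  unfolding resolvent_apply_def using resolvent_ex1[OF assms] by (rule theI')

lemma resolvent_apply_unique:
  assumes "\<not> eigenvalue B z" and "z *s w - B *v w = x"
  shows "resolvent_apply B z x = w"
  unfolding resolvent_apply_def using resolvent_ex1[OF assms(1)] assms(2) by (rule the1_equality)

text \<open>Apply the resolvent to (z - B) x = (z - a) x - (B - a) x and solve for its value at
  \<open>x\<close>. This matches the step of \<open>eigenvalue_induct\<close>.\<close>

lemma resolvent_apply_step:
  assumes z: "\<not> eigenvalue B z" and "z \<noteq> a"
  shows "resolvent_apply B z x
    = inverse (z - a) *s (x + resolvent_apply B z (B *v x - a *s x))"
proof (rule resolvent_apply_unique[OF z])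
  let ?r = "resolvent_apply B z (B *v x - a *s x)"
  have "z *s (inverse (z - a) *s (x + ?r)) - B *v (inverse (z - a) *s (x + ?r))
      = inverse (z - a) *s ((z *s x - B *v x) + (z *s ?r - B *v ?r))"
    by (simp add: vector_scalar_commute matrix_vector_right_distrib vec.scale_right_distrib
        vec.scale_right_diff_distrib mult.commute)
  also have "\<dots> = inverse (z - a) *s ((z - a) *s x)"
    unfolding resolvent_apply_eq[OF z] by (simp add: vec.scale_left_diff_distrib)
  also have "\<dots> = x"
    unfolding vec.scale_scale using assms(2) by simp
  finally show "z *s (inverse (z - a) *s (x + ?r)) - B *v (inverse (z - a) *s (x + ?r)) = x" .
qed

text \<open>Winding is expressed by an integral value \<open>c\<close>, later 2 pi i, because for
  the modified contour this integral is found by comparing primitives.\<close>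

locale contour_around_spectrum =
  fixes C :: "(real \<Rightarrow> complex) list" and B :: "complex^'n^'n" and c :: complex
  assumes closed: "closed_contour C"
    and disjoint: "\<And>a. eigenvalue B a \<Longrightarrow> a \<notin> contour_image C"
    and winding: "\<And>a. eigenvalue B a \<Longrightarrow> has_cycle_integral (\<lambda>z. inverse (z - a)) c C"
begin

text \<open>The extra factors are what resolvent_apply_step produces, so the claim is closed under it.\<close>

lemma has_cycle_integral_resolvent_prod:
  assumes add: "\<And>x y. \<phi> (x + y) = \<phi> x + \<phi> y" and scale: "\<And>a x. \<phi> (a *s x) = a * \<phi> x"
    and "\<And>a. a \<in># N \<Longrightarrow> eigenvalue B a"
  shows "has_cycle_integral (\<lambda>z. inverse (\<Prod>a\<in>#N. z - a) * \<phi> (resolvent_apply B z x))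
           (if N = {#} then c * \<phi> x else 0) C"
  using assms(3)
proof (induction x arbitrary: N rule: eigenvalue_induct[where B = B])
  case zero
  have "\<phi> 0 = 0"
    using scale[of 0 0] by simp
  show ?case
  proof (rule has_cycle_integral_cong[OF has_cycle_integral_0])
    fix z assume "z \<in> contour_image C"
    then have "resolvent_apply B z 0 = 0"
      using disjoint by (intro resolvent_apply_unique) auto
    then show "0 = inverse (\<Prod>a\<in>#N. z - a) * \<phi> (resolvent_apply B z 0)"
      by (simp add: \<open>\<phi> 0 = 0\<close>)
  qed (simp add: \<open>\<phi> 0 = 0\<close>)
next
  case (step b x)
  let ?N = "add_mset b N"
  have N: "\<And>a. a \<in># ?N \<Longrightarrow> eigenvalue B a"
    using step by auto
  have "has_cycle_integral (\<lambda>z. inverse (\<Prod>a\<in>#?N. z - a)) (if size ?N = 1 then c else 0) C"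
    using N disjoint winding by (intro has_cycle_integral_inverse_prod closed) auto
  note 1 = has_cycle_integral_lmul[OF this, of "\<phi> x"]
  \<comment> \<open>\<open>?N\<close> is nonempty, so the induction hypothesis gives 0. Only the
    first term can contribute, and only if \<open>N\<close> is empty.\<close>
  have 2: "has_cycle_integral (\<lambda>z. inverse (\<Prod>a\<in>#?N. z - a)
      * \<phi> (resolvent_apply B z (B *v x - b *s x))) 0 C"
    using step.IH[of ?N] N by simp
  show ?case
  proof (rule has_cycle_integral_cong[OF has_cycle_integral_add[OF 1 2]])
    fix z assume "z \<in> contour_image C"
    then have "\<not> eigenvalue B z" "z \<noteq> b"
      using disjoint step by auto
    note eq = resolvent_apply_step[OF this, of x]
    show "\<phi> x * inverse (\<Prod>a\<in>#?N. z - a) + inverse (\<Prod>a\<in>#?N. z - a)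
        * \<phi> (resolvent_apply B z (B *v x - b *s x))
        = inverse (\<Prod>a\<in>#N. z - a) * \<phi> (resolvent_apply B z x)"
      unfolding eq image_mset_add_mset prod_mset.add_mset
        inverse_mult_distrib scale add by (simp add: algebra_simps)
  qed auto
qed

text \<open>Writing R for the resolvent at \<open>z\<close>, z R x = x + B R x. The term with
  \<open>x\<close> leaves a pure power of \<open>z\<close>, which integrates to 0; the other is the
  induction hypothesis for \<open>\<phi>\<close> composed with \<open>B\<close>, hence the
  generalisation over \<open>\<phi>\<close>.\<close>

lemma has_cycle_integral_power_resolvent:
  assumes "\<And>x y. \<phi> (x + y) = \<phi> x + \<phi> y" and "\<And>a x. \<phi> (a *s x) = a * \<phi> x"
  shows "has_cycle_integral (\<lambda>z. z ^ k * \<phi> (resolvent_apply B z x)) (c * \<phi> (matrix_power B k *v x)) C"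
  using assms
proof (induction k arbitrary: \<phi>)
  case 0
  then show ?case
    using has_cycle_integral_resolvent_prod[of \<phi> "{#}" x] by simp
next
  case (Suc k)
  have "has_cycle_integral (\<lambda>z. z ^ k) 0 C"
  proof (rule has_cycle_integral_closed_primitive[OF closed])
    show "((\<lambda>z. z ^ Suc k / of_nat (Suc k)) has_field_derivative z ^ k) (at z)" for z :: complex
      by (rule DERIV_cong[OF DERIV_cdivide[OF DERIV_power_Suc[OF DERIV_ident]]])
        (use of_nat_neq_0[of k, where 'a = complex] in simp)
  qed
  note 1 = has_cycle_integral_lmul[OF this, of "\<phi> x"]
  have 2: "has_cycle_integral (\<lambda>z. z ^ k * \<phi> (B *v resolvent_apply B z x))
      (c * \<phi> (B *v (matrix_power B k *v x))) C"
    by (rule Suc.IH) (simp_all add: Suc.prems matrix_vector_right_distrib vector_scalar_commute)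
  show ?case
  proof (rule has_cycle_integral_cong[OF has_cycle_integral_add[OF 1 2]])
    fix z assume "z \<in> contour_image C"
    then have "z *s resolvent_apply B z x - B *v resolvent_apply B z x = x"
      using disjoint by (intro resolvent_apply_eq) auto
    then have "z *s resolvent_apply B z x = x + B *v resolvent_apply B z x"
      by (simp add: algebra_simps)
    then have "z * \<phi> (resolvent_apply B z x) = \<phi> x + \<phi> (B *v resolvent_apply B z x)"
      by (metis Suc.prems)
    then have "z ^ k * (z * \<phi> (resolvent_apply B z x))
        = z ^ k * (\<phi> x + \<phi> (B *v resolvent_apply B z x))"
      by simp
    then show "\<phi> x * z ^ k + z ^ k * \<phi> (B *v resolvent_apply B z x)
        = z ^ Suc k * \<phi> (resolvent_apply B z x)"
      by (simp add: algebra_simps)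
  qed (simp add: matrix_power_Suc_apply del: matrix_power.simps)
qed

end

subsection \<open>Pseudospectra and the contour in the left half-plane\<close>

text \<open>With y = z w - B w, the rank-one matrix E = y w* / |w|^2 maps \<open>w\<close> to
  \<open>y\<close> and has Frobenius norm |y| / |w|.\<close>

lemma mem_pseudospectrum_if_norm_le:
  fixes B :: "complex^'n^'n"
  assumes "w \<noteq> 0" and "norm (z *s w - B *v w) \<le> e * norm w"
  shows "z \<in> pseudospectrum e B"
proof -
  define y where "y = z *s w - B *v w"
  define w' where "w' = (\<chi> j. cnj (w $ j))"
  define E where "E = (\<chi> i. (y $ i / complex_of_real ((norm w)\<^sup>2)) *s w')"
  have w': "norm w' = norm w"
    by (simp add: w'_def norm_vec_def)
  have "norm E = L2_set (\<lambda>i. cmod (y $ i) * (norm w / (norm w)\<^sup>2)) UNIV"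
    unfolding norm_vec_def[of E]
    by (simp add: E_def norm_vector_scalar_mult norm_divide w' norm_power)
  also have "\<dots> = norm y * (norm w / (norm w)\<^sup>2)"
    unfolding norm_vec_def[of y] by (rule L2_set_left_distrib[symmetric]) simp
  also have "\<dots> \<le> e"
    using assms by (simp add: y_def power2_eq_square field_simps)
  finally have "norm E \<le> e" .
  have "(norm w)\<^sup>2 = (\<Sum>j\<in>UNIV. (cmod (w $ j))\<^sup>2)"
    by (simp add: norm_vec_def L2_set_def sum_nonneg)
  then have "complex_of_real ((norm w)\<^sup>2) = (\<Sum>j\<in>UNIV. w' $ j * w $ j)"
    by (simp add: w'_def complex_norm_square mult.commute del: of_real_power)
  then have sum: "(\<Sum>j\<in>UNIV. w' $ j * w $ j) = complex_of_real ((norm w)\<^sup>2)" ..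
  have "(E *v w) $ i = y $ i" for i
  proof -
    have "(E *v w) $ i = y $ i / complex_of_real ((norm w)\<^sup>2) * (\<Sum>j\<in>UNIV. w' $ j * w $ j)"
      by (simp add: E_def matrix_vector_mult_def mult.assoc sum_distrib_left del: of_real_power)
    then show ?thesis
      unfolding sum using assms(1) by simp
  qed
  then have "E *v w = y"
    by (simp add: vec_eq_iff)
  then have "(B + E) *v w = z *s w"
    by (simp add: y_def matrix_vector_mult_add_rdistrib)
  then show ?thesis
    using \<open>norm E \<le> e\<close> assms(1) by (auto simp: pseudospectrum_def eigenvalue_def)
qed

text \<open>A vector \<open>w\<close> violating the bound at \<open>z\<close> has some slack, so it
  certifies membership in the pseudospectrum for a whole ball around \<open>z\<close>.\<close>

lemma norm_ge_if_notin_interior_pseudospectrum: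
  fixes B :: "complex^'n^'n"
  assumes "z \<notin> interior (pseudospectrum e B)"
  shows "e * norm w \<le> norm (z *s w - B *v w)"
proof (rule ccontr)
  assume neg: "\<not> e * norm w \<le> norm (z *s w - B *v w)"
  then have "w \<noteq> 0"
    by auto
  define r where "r = (e * norm w - norm (z *s w - B *v w)) / norm w"
  have "r > 0"
    using neg \<open>w \<noteq> 0\<close> by (simp add: r_def)
  moreover have "ball z r \<subseteq> pseudospectrum e B"
  proof
    fix z' assume "z' \<in> ball z r"
    then have z': "cmod (z' - z) < r"
      by (simp add: dist_norm norm_minus_commute)
    have "z' *s w - B *v w = (z *s w - B *v w) + (z' - z) *s w"
      by (simp add: vec.scale_left_diff_distrib)
    then have "norm (z' *s w - B *v w) \<le> norm (z *s w - B *v w) + cmod (z' - z) * norm w"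
      by (metis norm_triangle_ineq norm_vector_scalar_mult)
    also have "\<dots> \<le> norm (z *s w - B *v w) + r * norm w"
      using z' by (simp add: mult_right_mono)
    also have "\<dots> = e * norm w"
      using \<open>w \<noteq> 0\<close> by (simp add: r_def)
    finally show "z' \<in> pseudospectrum e B"
      using \<open>w \<noteq> 0\<close> by (rule mem_pseudospectrum_if_norm_le[rotated])
  qed
  ultimately show False
    using assms by (auto simp: mem_interior)
qed

lemma eigenvalue_in_interior_pseudospectrum:
  assumes "eigenvalue B z" and "0 < e"
  shows "z \<in> interior (pseudospectrum e B)"
proof (rule ccontr)
  assume *: "z \<notin> interior (pseudospectrum e B)"
  obtain w where "w \<noteq> 0" "B *v w = z *s w"
    using assms(1) by (auto simp: eigenvalue_def)
  then show False
    using norm_ge_if_notin_interior_pseudospectrum[OF *, of w] assms(2)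
    by (simp add: mult_le_0_iff)
qed

lemma pseudospectrum_perturb_subset:
  assumes "norm D \<le> d"
  shows "pseudospectrum e (A + D) \<subseteq> pseudospectrum (e + d) A"
proof
  fix z assume "z \<in> pseudospectrum e (A + D)"
  then obtain E where "norm E \<le> e" "eigenvalue (A + D + E) z"
    by (auto simp: pseudospectrum_def)
  then have "norm (D + E) \<le> e + d" "eigenvalue (A + (D + E)) z"
    using assms norm_triangle_ineq[of D E] by (auto simp: add.assoc)
  then show "z \<in> pseudospectrum (e + d) A"
    by (auto simp: pseudospectrum_def)
qed

text \<open>An interior point can be shifted to the right by some r > 0 within \<open>K\<close>,
  which turns the weak inequality into a strict one.\<close>

lemma Re_neg_if_in_interior:
  assumes "no_unstable_points K" and "z \<in> interior K"
  shows "Re z < 0"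
proof -
  obtain r where r: "r > 0" "cball z r \<subseteq> K"
    using assms(2) by (auto simp: mem_interior_cball)
  then have "z + of_real r \<in> K"
    by (auto simp: dist_norm)
  then show ?thesis
    using r(1) assms(1) by (auto simp: no_unstable_points_def)
qed

text \<open>The arcs \<open>L\<close> avoid the interior of \<open>K\<close> by
  \<open>surrounds\<close>. The intervals \<open>J\<close> may cross it, but only on the imaginary
  axis, hence the restriction to negative real part.\<close>

lemma left_half_contour_image:
  assumes "left_half_contour K G" and "z \<in> contour_image G"
  shows "Re z \<le> 0" and "Re z < 0 \<Longrightarrow> z \<notin> interior K"
proof -
  obtain L R J where *: "surrounds (L @ R) K" "contour_image L \<subseteq> {z. Re z \<le> 0}"
      "\<forall>g\<in>set J. \<exists>a b. g = linepath (\<i> * complex_of_real a) (\<i> * complex_of_real b)" "G = L @ J"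
    using assms(1) unfolding left_half_contour_def by blast
  have J: "Re z = 0" if "z \<in> contour_image J"
    using that *(3) by (fastforce simp: contour_image_def in_segment)
  have L: "Re z \<le> 0 \<and> z \<notin> interior K" if "z \<in> contour_image L"
    using that *(1,2) by (auto simp: surrounds_def contour_image_def)
  have "z \<in> contour_image L \<or> z \<in> contour_image J"
    using assms(2) *(4) by (auto simp: contour_image_def)
  then show "Re z \<le> 0" "Re z < 0 \<Longrightarrow> z \<notin> interior K"
    using J L by auto
qed

text \<open>Since \<open>inverse (z - a)\<close> has a primitive on the closed right half-plane, exchanging the arcs in
  this half-plane for others with the same end points does not change the integral.\<close>

lemma has_cycle_integral_left_half_contour:
  assumes "left_half_contour K G" and a: "a \<in> interior K" "Re a < 0"
  shows "has_cycle_integral (\<lambda>z. inverse (z - a)) (2 * pi * \<i>) G"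
proof -
  obtain L R J where LR: "closed_contour (L @ R)" "surrounds (L @ R) K"
      and R: "contour_image R \<subseteq> {z. Re z \<ge> 0}"
      and J: "\<forall>g\<in>set J. \<exists>a b. g = linepath (\<i> * complex_of_real a) (\<i> * complex_of_real b)"
      and G: "G = L @ J" "closed_contour G"
    using assms(1) unfolding left_half_contour_def by blast
  have J0: "contour_image J \<subseteq> {z. Re z \<ge> 0}"
    using J by (fastforce simp: contour_image_def in_segment)
  let ?f = "\<lambda>z. inverse (z - a)" and ?F = "\<lambda>z. Ln (z - a)"
  have valid: "\<And>g. g \<in> set L \<union> set R \<union> set J \<Longrightarrow> valid_path g"
    using LR G by (auto simp: closed_contour_def)
  have a_notin: "a \<notin> contour_image (L @ R)" "a \<in> K"
    using LR(2) a interior_subset by (auto simp: surrounds_def)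
  then have "a \<notin> contour_image L"
    by (auto simp: contour_image_def)
  then have L: "has_cycle_integral ?f (2 * pi * \<i> * (\<Sum>g\<leftarrow>L. winding_number g a)) L"
    using valid by (intro has_cycle_integral_inverse_diff) auto
  have right: "has_cycle_integral ?f (\<Sum>g\<leftarrow>X. ?F (pathfinish g) - ?F (pathstart g)) X"
    if "set X \<subseteq> set R \<union> set J" "contour_image X \<subseteq> {z. Re z \<ge> 0}" for X
  proof (rule has_cycle_integral_primitive)
    show "(?F has_field_derivative ?f z) (at z)" if "z \<in> {z. Re z \<ge> 0}" for z
    proof -
      \<comment> \<open>Here z - a has positive real part, away from the branch cut of
        \<open>Ln\<close>.\<close>
      have "z - a \<notin> \<real>\<^sub>\<le>\<^sub>0"
        using that a(2) by (auto simp: complex_nonpos_Reals_iff)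
      then show ?thesis
        by (auto intro!: derivative_eq_intros)
    qed
  qed (use that valid in auto)
  have "has_cycle_integral ?f (2 * pi * \<i> * (\<Sum>g\<leftarrow>L @ R. winding_number g a)) (L @ R)"
    using a_notin(1) valid by (intro has_cycle_integral_inverse_diff) auto
  moreover have "(\<Sum>g\<leftarrow>L @ R. winding_number g a) = 1"
    using LR(2) a_notin unfolding surrounds_def by blast
  \<comment> \<open>The integral over \<open>L @ R\<close> is computed twice: by the winding number
    1, and as the part over \<open>L\<close> plus logarithm differences over
    \<open>R\<close>.\<close>
  ultimately have LR_eq: "2 * pi * \<i> * (\<Sum>g\<leftarrow>L. winding_number g a)
      + (\<Sum>g\<leftarrow>R. ?F (pathfinish g) - ?F (pathstart g)) = 2 * pi * \<i>"
    using has_cycle_integral_unique has_cycle_integral_append[OF L right[OF _ R]] by fastforce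
  \<comment> \<open>Both \<open>L @ R\<close> and \<open>L @ J\<close> close up, so each of the two
    sums cancels the sum over \<open>L\<close>.\<close>
  have "(\<Sum>g\<leftarrow>R. ?F (pathfinish g) - ?F (pathstart g))
      = (\<Sum>g\<leftarrow>J. ?F (pathfinish g) - ?F (pathstart g))"
    using sum_pathstart_eq_pathfinish[OF LR(1), of ?F]
      sum_pathstart_eq_pathfinish[OF G(2)[unfolded G(1)], of ?F]
    unfolding sum_list_subtractf map_append sum_list_append by algebra
  then show ?thesis
    using has_cycle_integral_append[OF L right[OF _ J0]] LR_eq G(1) by simp
qed

subsection \<open>The bound on the exponential\<close>

lemma matrix_power_scaleR:
  fixes B :: "complex^'n^'n"
  shows "matrix_power (t *\<^sub>R B) k = t ^ k *\<^sub>R matrix_power B k"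
proof (induction k)
  case (Suc k)
  have "(t *\<^sub>R B) ** (t ^ k *\<^sub>R M) = t ^ Suc k *\<^sub>R (B ** M)" for M :: "complex^'n^'n"
    by (simp add: vec_eq_iff matrix_matrix_mult_def scaleR_sum_right mult.commute)
  then show ?case
    using Suc by simp
qed simp

text \<open>Left multiplication by \<open>M\<close> has an operator bound \<open>K\<close>, so the
  terms are dominated by a multiple of the series for exp K.\<close>

lemma summable_matrix_exp:
  fixes M :: "complex^'n^'n"
  shows "summable (\<lambda>k. (1 / fact k) *\<^sub>R matrix_power M k)"
proof -
  have "linear (\<lambda>P :: complex^'n^'n. M ** P)"
    by (rule linearI)
      (simp_all add: vec_eq_iff matrix_matrix_mult_def scaleR_sum_right distrib_left sum.distrib)
  then obtain K where K: "\<And>P :: complex^'n^'n. norm (M ** P) \<le> norm P * K" "K > 0"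
    using bounded_linear.pos_bounded unfolding linear_conv_bounded_linear by metis
  have power: "norm (matrix_power M k) \<le> norm (mat 1 :: complex^'n^'n) * K ^ k" for k
  proof (induction k)
    case (Suc k)
    have "norm (matrix_power M (Suc k)) \<le> norm (matrix_power M k) * K"
      by (simp add: K)
    also have "\<dots> \<le> norm (mat 1 :: complex^'n^'n) * K ^ k * K"
      using Suc K by (simp add: mult_right_mono)
    finally show ?case
      by (simp add: mult_ac)
  qed simp
  have "summable (\<lambda>k. norm (mat 1 :: complex^'n^'n) * (inverse (fact k) * K ^ k))"
    by (intro summable_mult summable_exp)
  then show ?thesis
    by (rule summable_comparison_test') (use power in \<open>simp add: field_simps\<close>)
qed

lemma matrix_exp_apply_sums:
  fixes B :: "complex^'n^'n"
  shows "(\<lambda>k. (t ^ k / fact k) *\<^sub>R (matrix_power B k *v x)) sums (matrix_exp (t *\<^sub>R B) *v x)"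
proof -
  have scale: "(r *\<^sub>R M) *v x = r *\<^sub>R (M *v x)" for r and M :: "complex^'n^'n"
    by (simp add: vec_eq_iff matrix_vector_mult_def scaleR_sum_right)
  have "bounded_linear (\<lambda>M :: complex^'n^'n. M *v x)"
    unfolding linear_conv_bounded_linear[symmetric]
    by (rule linearI) (simp_all add: matrix_vector_mult_add_rdistrib scale)
  then have "(\<lambda>k. ((1 / fact k) *\<^sub>R matrix_power (t *\<^sub>R B) k) *v x) sums (matrix_exp (t *\<^sub>R B) *v x)"
    unfolding matrix_exp_def by (rule bounded_linear.sums[OF _ summable_sums[OF summable_matrix_exp]])
  then show ?thesis
    by (simp add: matrix_power_scaleR scale)
qed

lemma compact_contour_image:
  assumes "closed_contour C"
  shows "compact (contour_image C)"
  using assms unfolding contour_image_def closed_contour_def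
  by (intro compact_UN) (auto intro: compact_path_image valid_path_imp_path)

text \<open>The Dunford--Taylor representation is only used for the partial sums of the exponential
  series, so no interchange of integral and limit is needed.\<close>

lemma spectral_norm_matrix_exp_le:
  fixes B :: "complex^'n^'n"
  assumes "contour_around_spectrum G B (2 * pi * \<i>)"
    and left: "\<And>z. z \<in> contour_image G \<Longrightarrow> Re z \<le> 0"
    and "0 < e"
    and resolvent: "\<And>z w. z \<in> contour_image G \<Longrightarrow> e * norm w \<le> norm (z *s w - B *v w)"
    and "0 < t"
  shows "spectral_norm (matrix_exp (t *\<^sub>R B)) \<le> contour_length G / (2 * pi * e)"
proof -
  interpret contour_around_spectrum G B "2 * pi * \<i>"
    by fact
  let ?s = "\<lambda>N z. \<Sum>k<N. complex_of_real (t ^ k / fact k) * z ^ k"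
  let ?E = "\<lambda>N x. \<Sum>k<N. (t ^ k / fact k) *\<^sub>R (matrix_power B k *v x)"
  have length_nonneg: "contour_length G \<ge> 0"
  proof -
    have "path_length g \<ge> 0" if "g \<in> set G" for g
      unfolding path_length_def
      by (rule Henstock_Kurzweil_Integration.integral_nonneg)
        (use closed that in \<open>auto simp: closed_contour_def\<close>)
    then show ?thesis
      unfolding contour_length_def by (intro sum_list_nonneg) auto
  qed
  \<comment> \<open>The partial sums converge uniformly on the compact contour to exp (t z), of
    modulus at most 1 there; \<open>\<eta>\<close> absorbs the truncation error.\<close>
  have s_bound: "eventually (\<lambda>N. \<forall>z\<in>contour_image G. cmod (?s N z) \<le> 1 + \<eta>) sequentially"
    if "\<eta> > 0" for \<eta>
  proof -
    obtain r where r: "\<And>z. z \<in> contour_image G \<Longrightarrow> cmod z \<le> r"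
      using compact_imp_bounded[OF compact_contour_image[OF closed]] by (auto simp: bounded_iff)
    have "uniform_limit (contour_image G) (\<lambda>N z. \<Sum>k<N. (of_real t * z) ^ k /\<^sub>R fact k)
        (\<lambda>z. \<Sum>k. (of_real t * z) ^ k /\<^sub>R fact k) sequentially"
    proof (rule Weierstrass_m_test)
      show "summable (\<lambda>k. inverse (fact k) * (t * r) ^ k)"
        by (rule summable_exp)
      show "norm ((complex_of_real t * z) ^ k /\<^sub>R fact k) \<le> inverse (fact k) * (t * r) ^ k"
        if "z \<in> contour_image G" for z k
        using r[OF that] \<open>0 < t\<close>
        by (auto simp: norm_mult norm_power intro!: mult_left_mono power_mono)
    qed
    then have "eventually (\<lambda>N. \<forall>z\<in>contour_image G. dist (\<Sum>k<N. (of_real t * z) ^ k /\<^sub>R fact k)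
        (exp (of_real t * z)) < \<eta>) sequentially"
      using that by (simp add: uniform_limit_iff exp_def)
    then show ?thesis
    proof eventually_elim
      case (elim N)
      show ?case
      proof
        fix z assume z: "z \<in> contour_image G"
        have "?s N z = (\<Sum>k<N. (of_real t * z) ^ k /\<^sub>R fact k)"
          by (simp add: scaleR_conv_of_real power_mult_distrib field_simps)
        then have "cmod (?s N z - exp (of_real t * z)) < \<eta>"
          using elim z by (simp add: dist_norm)
        moreover have "cmod (exp (of_real t * z)) \<le> 1"
          using left[OF z] \<open>0 < t\<close> by (simp add: mult_le_0_iff)
        ultimately show "cmod (?s N z) \<le> 1 + \<eta>"
          using norm_triangle_ineq2[of "?s N z" "exp (of_real t * z)"] by linarith
      qed
    qed
  qed
  have "norm (matrix_exp (t *\<^sub>R B) *v x) \<le> contour_length G / (2 * pi * e) * norm x" for x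
  proof -
    define u where "u = matrix_exp (t *\<^sub>R B) *v x"
    \<comment> \<open>Pairing with \<open>u\<close> itself reduces the vector estimate to scalar
      integrals and recovers the squared norm of \<open>u\<close> as
      \<open>\<phi> u\<close>.\<close>
    define \<phi> where "\<phi> w = (\<Sum>i\<in>UNIV. cnj (u $ i) * w $ i)" for w :: "complex^'n"
    have add: "\<phi> (x + y) = \<phi> x + \<phi> y" and scale: "\<phi> (a *s x) = a * \<phi> x" for x y a
      by (simp_all add: \<phi>_def algebra_simps sum.distrib sum_distrib_left)
    have \<phi>_sum: "\<phi> (?E N x) = (\<Sum>k<N. complex_of_real (t ^ k / fact k) * \<phi> (matrix_power B k *v x))" for N
    proof (induction N)
      case 0
      then show ?case
        by (simp add: \<phi>_def)
    qed (simp add: add scale scaleR_eq_vector_scalar_mult)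
    have \<phi>_u: "\<phi> u = of_real ((norm u)\<^sup>2)"
    proof -
      have "(norm u)\<^sup>2 = (\<Sum>j\<in>UNIV. (cmod (u $ j))\<^sup>2)"
        by (simp add: norm_vec_def L2_set_def sum_nonneg)
      then show ?thesis
        by (simp add: \<phi>_def complex_norm_square mult.commute del: of_real_power)
    qed
    have \<phi>_le: "cmod (\<phi> w) \<le> norm u * norm w" for w
    proof -
      have "cmod (\<phi> w) \<le> (\<Sum>i\<in>UNIV. \<bar>cmod (u $ i)\<bar> * \<bar>cmod (w $ i)\<bar>)"
        unfolding \<phi>_def by (rule order_trans[OF norm_sum]) (simp add: norm_mult)
      also have "\<dots> \<le> norm u * norm w"
        unfolding norm_vec_def by (rule L2_set_mult_ineq)
      finally show ?thesis .
    qed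
    have integral: "has_cycle_integral (\<lambda>z. ?s N z * \<phi> (resolvent_apply B z x))
        (2 * pi * \<i> * \<phi> (?E N x)) G" for N
    proof -
      have "has_cycle_integral (\<lambda>z. \<Sum>k<N. complex_of_real (t ^ k / fact k)
              * (z ^ k * \<phi> (resolvent_apply B z x)))
          (\<Sum>k<N. complex_of_real (t ^ k / fact k) * (2 * pi * \<i> * \<phi> (matrix_power B k *v x))) G"
        by (intro has_cycle_integral_sum has_cycle_integral_lmul
            has_cycle_integral_power_resolvent add scale) simp
      then show ?thesis
        by (rule has_cycle_integral_cong)
          (simp_all add: \<phi>_sum sum_distrib_left sum_distrib_right mult_ac)
    qed
    have \<phi>_resolvent: "cmod (\<phi> (resolvent_apply B z x)) \<le> norm u * (norm x / e)"
      if "z \<in> contour_image G" for z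
    proof -
      have "\<not> eigenvalue B z"
        using disjoint that by blast
      then have "norm (resolvent_apply B z x) \<le> norm x / e"
        using resolvent[OF that, of "resolvent_apply B z x"] \<open>0 < e\<close>
        by (simp add: resolvent_apply_eq field_simps)
      then show ?thesis
        using \<phi>_le by (meson mult_left_mono norm_ge_zero order_trans)
    qed
    let ?c = "norm u * (norm x / e) * contour_length G"
    \<comment> \<open>For fixed \<open>\<eta>\<close> the number of terms tends to infinity;
      afterwards \<open>\<eta>\<close> tends to 0.\<close>
    have approx: "2 * pi * (norm u)\<^sup>2 \<le> (1 + \<eta>) * ?c" if "\<eta> > 0" for \<eta>
    proof -
      have "(\<lambda>N. \<phi> (?E N x)) \<longlonglongrightarrow> \<phi> u"
        using matrix_exp_apply_sums[of t B x] unfolding \<phi>_def u_def[symmetric] sums_def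
        by (intro tendsto_intros)
      then have "(\<lambda>N. 2 * pi * cmod (\<phi> (?E N x))) \<longlonglongrightarrow> 2 * pi * cmod (\<phi> u)"
        by (intro tendsto_intros)
      moreover have "eventually (\<lambda>N. 2 * pi * cmod (\<phi> (?E N x)) \<le> (1 + \<eta>) * ?c) sequentially"
        using s_bound[OF that]
      proof eventually_elim
        case (elim N)
        have "cmod (2 * pi * \<i> * \<phi> (?E N x)) \<le> (1 + \<eta>) * (norm u * (norm x / e)) * contour_length G"
        proof (rule has_cycle_integral_norm_le[OF integral closed])
          fix z assume z: "z \<in> contour_image G"
          show "cmod (?s N z * \<phi> (resolvent_apply B z x)) \<le> (1 + \<eta>) * (norm u * (norm x / e))"
            unfolding norm_mult
            by (rule mult_mono[OF elim[rule_format, OF z] \<phi>_resolvent[OF z]]) (use that in auto)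
        qed
        then show ?case
          by (simp add: norm_mult mult.assoc)
      qed
      ultimately have "2 * pi * cmod (\<phi> u) \<le> (1 + \<eta>) * ?c"
        by (rule tendsto_upperbound) simp
      then show ?thesis
        by (simp add: \<phi>_u norm_power)
    qed
    have "2 * pi * (norm u)\<^sup>2 \<le> ?c"
    proof (rule tendsto_lowerbound)
      show "((\<lambda>\<eta>. (1 + \<eta>) * ?c) \<longlongrightarrow> ?c) (at_right 0)"
        using \<open>0 < e\<close> by (auto intro!: tendsto_eq_intros)
      show "eventually (\<lambda>\<eta>. 2 * pi * (norm u)\<^sup>2 \<le> (1 + \<eta>) * ?c) (at_right 0)"
        using approx by (auto simp: eventually_at_filter)
    qed simp
    \<comment> \<open>One factor \<open>norm u\<close> is to be cancelled; if u = 0, the bound is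
      just nonnegativity of the contour length.\<close>
    then have "norm u * (2 * pi * e * norm u) \<le> norm u * (norm x * contour_length G)"
      using \<open>0 < e\<close> by (simp add: field_simps power2_eq_square)
    then have "2 * pi * e * norm u \<le> norm x * contour_length G"
      using length_nonneg by (cases "u = 0") (auto simp: mult_le_cancel_left)
    then show ?thesis
      using \<open>0 < e\<close> unfolding u_def[symmetric] by (simp add: field_simps)
  qed
  then show ?thesis
    unfolding spectral_norm_def by (rule onorm_le)
qed

theorem proposition2p1:
  fixes A :: "complex^'n^'n" and S :: "(complex^'n^'n) set"
    and \<epsilon> \<epsilon>star \<delta> :: real and \<Gamma> :: "(real \<Rightarrow> complex) list"
  assumes "\<And>z. eigenvalue A z \<Longrightarrow> Re z < 0"
    and "subspace S" (* real-linear; this includes the complex-linear subspaces *)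
    and "is_stability_radius A \<epsilon>star"
    and "0 < \<epsilon>" and "\<epsilon> < \<epsilon>star"
    and "is_structured_stability_radius S \<epsilon> A \<delta>"
    and "left_half_contour (pseudospectrum (\<epsilon> + \<delta>) A) \<Gamma>"
  shows "\<forall>\<Delta>\<in>S. norm \<Delta> \<le> \<delta> \<longrightarrow>
           (\<forall>t>0. spectral_norm (matrix_exp (t *\<^sub>R (A + \<Delta>))) \<le> contour_length \<Gamma> / (2 * pi * \<epsilon>))"
proof (intro ballI impI allI)
  fix \<Delta> and t :: real
  assume \<Delta>: "\<Delta> \<in> S" "norm \<Delta> \<le> \<delta>" and "0 < t"
  let ?K = "pseudospectrum (\<epsilon> + \<delta>) A"
  \<comment> \<open>A largest admissible radius is itself admissible, so the case of norm exactly
    \<open>\<delta>\<close> is covered.\<close>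
  have stable: "no_unstable_points (pseudospectrum \<epsilon> (A + \<Delta>))"
    using assms(6) \<Delta> by (auto simp: is_structured_stability_radius_def is_largest_def)
  have interior: "Re z < 0" "z \<in> interior ?K" if "z \<in> interior (pseudospectrum \<epsilon> (A + \<Delta>))" for z
    using Re_neg_if_in_interior[OF stable that] that
      interior_mono[OF pseudospectrum_perturb_subset[OF \<Delta>(2)]] by auto
  \<comment> \<open>These interior points have negative real part, so they miss the imaginary axis,
    and lie in the interior of \<open>?K\<close>, so they miss the rest of
    \<open>\<Gamma>\<close>.\<close>
  then have disjoint: "contour_image \<Gamma> \<inter> interior (pseudospectrum \<epsilon> (A + \<Delta>)) = {}"
    using left_half_contour_image(2)[OF assms(7)] by blast
  have "contour_around_spectrum \<Gamma> (A + \<Delta>) (2 * pi * \<i>)"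
  proof
    show "closed_contour \<Gamma>"
      using assms(7) by (auto simp: left_half_contour_def)
    fix a assume "eigenvalue (A + \<Delta>) a"
    then have a: "a \<in> interior (pseudospectrum \<epsilon> (A + \<Delta>))"
      using assms(4) by (rule eigenvalue_in_interior_pseudospectrum)
    then show "a \<notin> contour_image \<Gamma>"
      using disjoint by blast
    show "has_cycle_integral (\<lambda>z. inverse (z - a)) (2 * pi * \<i>) \<Gamma>"
      using interior[OF a] assms(7) by (intro has_cycle_integral_left_half_contour)
  qed
  then show "spectral_norm (matrix_exp (t *\<^sub>R (A + \<Delta>))) \<le> contour_length \<Gamma> / (2 * pi * \<epsilon>)"
    using left_half_contour_image(1)[OF assms(7)] assms(4) \<open>0 < t\<close> disjoint
    by (intro spectral_norm_matrix_exp_le norm_ge_if_notin_interior_pseudospectrum) auto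
qed

end
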